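(* Let $1<k\in\mathbb{Z}$. To each $k$-germ $\alpha=a_{k-1}\cdots a_1$ corresponds a $(2k+1)$-string $F(\alpha)=f_0f_1\cdots f_{2k}$ whose entries are the numbers $0,1,\ldots,k$ (once each) together with $k$ asterisks $*$, and such that: (A) $F(0^{k-1})=012\cdots(k-2)(k-1)k*\cdots*$; (B) if $\alpha\ne 0^{k-1}$, with $a_i$ the rightmost nonzero entry of $\alpha$ ($k>i\ge 1$), then $F(\alpha)$ is obtained from $F(\beta(\alpha))=h_0h_1\cdots h_{2k}$ by the following Castling Procedure: 1. let $W^i=h_0h_1\cdots h_{i-1}$ and $Z^i=h_{2k-i+1}\cdots h_{2k-1}h_{2k}$ be respectively the initial and terminal substrings of length $i$ of $F(\beta(\alpha))$ (these are also the initial and terminal substrings of length $i$ of $F(\alpha)$); 2. let $\Omega>0$ be the leftmost entry of the substring $U$ obtained from $F(\beta(\alpha))$ by removing $W^i$ and $Z^i$, and write $U$ as the concatenation $U=X|Y$ with $Y$ starting at the entry $\Omega+1$, so that $F(\beta(\alpha))=W^i|X|Y|Z^i$; 3. set $F(\alpha)=W^i|Y|X|Z^i$. In particular: (a) the leftmost entry of each $F(\alpha)$ is $0$; $k*$ is a substring of $F(\alpha)$, but $*k$ is not; (b) a number to the immediate right of any $b\in\{0,\ldots,k-1\}$ in $F(\alpha)$ is larger than $b$; (c) for each $\alpha\neq 0^{k-1}$, $W^i$ is an ascending string of $i$ numbers and $Z^i$ is formed by $i$ of the $k$ asterisks.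
   Context: For $1<k\in\mathbb{Z}$, a $k$-germ is a $(k-1)$-string $\alpha=a_{k-1}a_{k-2}\cdots a_2a_1$ of nonnegative integers with $a_{k-1}\in\{0,1\}$ and $0\le a_{i-1}\le a_i+1$ for $1<i<k$. The null $k$-germ is $0^{k-1}=0\cdots 0$. For a $k$-germ $\alpha=a_{k-1}\cdots a_1\ne 0^{k-1}$ whose rightmost nonzero entry is $a_i$ (that is, $a_i\neq0$ and $a_j=0$ for all $j<i$), $\beta(\alpha)=b_{k-1}\cdots b_1$ denotes the $k$-germ with $b_i=a_i-1$ and $b_j=a_j$ for $j\ne i$. Iterating $\alpha\mapsto\beta(\alpha)$ eventually leads to $0^{k-1}$, so (A) and (B) define $F$ recursively. The bar $|$ denotes concatenation of strings; "substring" means a substring of consecutive entries. *)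

theory Defs
  imports "HOL-Library.Multiset" "HOL-Library.Sublist"
begin

text \<open>
  Strings are written from left to right as lists, so the leftmost entry of a list representing
  the string \<open>a\<^sub>k\<^sub>-\<^sub>1 \<dots> a\<^sub>2 a\<^sub>1\<close> is \<open>a\<^sub>k\<^sub>-\<^sub>1\<close>.  The subscripts of a germ therefore
  count positions from the right, starting with 1.
\<close>

definition germ_entry :: "nat list \<Rightarrow> nat \<Rightarrow> nat" where
  "germ_entry \<alpha> i = \<alpha> ! (length \<alpha> - i)"

definition germs :: "nat \<Rightarrow> nat list set" where
  "germs k = {\<alpha>. length \<alpha> = k - 1 \<and> germ_entry \<alpha> (k - 1) \<in> {0, 1} \<and>
     (\<forall>i. 1 < i \<and> i < k \<longrightarrow> germ_entry \<alpha> (i - 1) \<le> germ_entry \<alpha> i + 1)}"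

definition null_germ :: "nat \<Rightarrow> nat list" where
  "null_germ k = replicate (k - 1) 0"

text \<open>The subscript of the rightmost nonzero entry; meaningful only if there is a nonzero entry.\<close>

definition rightmost_nonzero :: "nat list \<Rightarrow> nat" where
  "rightmost_nonzero \<alpha> = (LEAST i. 1 \<le> i \<and> i \<le> length \<alpha> \<and> germ_entry \<alpha> i \<noteq> 0)"

definition germ_pred :: "nat list \<Rightarrow> nat list" where
  "germ_pred \<alpha> = (let i = rightmost_nonzero \<alpha> in \<alpha>[length \<alpha> - i := germ_entry \<alpha> i - 1])"

datatype entry = Num nat | Star

definition castling_strings :: "nat \<Rightarrow> entry list set" where
  "castling_strings k = {f. length f = 2 * k + 1 \<and>
     mset f = image_mset Num (mset_set {0..k}) + replicate_mset k Star}"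

definition initial_substring :: "nat \<Rightarrow> 'a list \<Rightarrow> 'a list" where
  "initial_substring i h = take i h"

definition terminal_substring :: "nat \<Rightarrow> 'a list \<Rightarrow> 'a list" where
  "terminal_substring i h = drop (length h - i) h"

text \<open>
  The Castling Procedure is a relation between the old string \<open>h\<close> and the new string \<open>g\<close>, so that
  nothing is presupposed about its applicability: that the entry \<open>\<Omega>\<close> at the left end of the middle
  part \<open>X @ Y\<close> is a positive number, and that \<open>\<Omega> + 1\<close> occurs in the middle part, are
  requirements.
\<close>

definition castling :: "nat \<Rightarrow> entry list \<Rightarrow> entry list \<Rightarrow> bool" where
  "castling i h g \<longleftrightarrow> (\<exists>X Y \<Omega>.
     h = initial_substring i h @ X @ Y @ terminal_substring i h \<and>
     X \<noteq> [] \<and> hd X = Num \<Omega> \<and> 0 < \<Omega> \<and>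
     Y \<noteq> [] \<and> hd Y = Num (\<Omega> + 1) \<and>
     g = initial_substring i h @ Y @ X @ terminal_substring i h)"

definition castling_recursion :: "nat \<Rightarrow> (nat list \<Rightarrow> entry list) \<Rightarrow> bool" where
  "castling_recursion k F \<longleftrightarrow>
     F (null_germ k) = map Num [0..<k + 1] @ replicate k Star \<and>
     (\<forall>\<alpha> \<in> germs k. \<alpha> \<noteq> null_germ k \<longrightarrow>
        castling (rightmost_nonzero \<alpha>) (F (germ_pred \<alpha>)) (F \<alpha>))"

definition ascending_numbers :: "entry list \<Rightarrow> bool" where
  "ascending_numbers w \<longleftrightarrow> (\<exists>ns. w = map Num ns \<and> sorted_wrt (<) ns)"

end

theory Submission
  imports Defs
begin

text \<open>
  Read \<open>Num\<close> as an up step and \<open>Star\<close> as a down step, so that a string is an ordered tree whose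
  vertices carry the numbers as labels.  The vertices \<open>0, \<dots>, i - 1\<close> of the tree of a germ with
  \<open>a\<^sub>1 = \<dots> = a\<^sub>i\<^sub>-\<^sub>1 = 0\<close> form a path hanging from the root; if moreover \<open>a\<^sub>i = 0\<close>, then \<open>i\<close>
  is the only child of \<open>i - 1\<close> and has \<open>n = a\<^sub>i\<^sub>+\<^sub>1 + 1\<close> children (with \<open>a\<^sub>k = 0\<close>), labelled
  \<open>i + n, \<dots>, i + 1\<close> from left to right.  A castling of index \<open>i\<close> takes the rightmost remaining
  child of \<open>i\<close> and makes it the leftmost child of \<open>i - 1\<close>, so it is possible exactly
  \<open>n\<close> times, which is the bound \<open>a\<^sub>i \<le> a\<^sub>i\<^sub>+\<^sub>1 + 1\<close> on germs.  After \<open>a\<^sub>i\<close> castlings the children of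
  \<open>i - 1\<close> are \<open>i + a\<^sub>i, \<dots>, i\<close>, and the process continues with \<open>i - 1\<close>.
  This yields a closed form for \<open>F\<close>.
\<close>

text \<open>A block is the traversal of a subtree without its final down step; that step is the
  \<open>Star\<close> added here.\<close>

definition close_blocks :: "entry list list \<Rightarrow> entry list" where
  "close_blocks E = concat (map (\<lambda>B. B @ [Star]) E)"

text \<open>All \<open>a\<close> castlings of index \<open>i\<close> at once: the last
  \<open>a\<close> branches at \<open>i\<close> become siblings to the left of \<open>i\<close>,
  which keeps the others below it.\<close>

definition raise_blocks :: "nat \<Rightarrow> nat \<Rightarrow> entry list list \<Rightarrow> entry list list" where
  "raise_blocks i a E =
     drop (length E - a) E @ [Num i # close_blocks (take (length E - a) E)]"

primrec germ_blocks :: "entry list list \<Rightarrow> nat list \<Rightarrow> entry list list" where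
  "germ_blocks E [] = E"
| "germ_blocks E (a # \<alpha>) = germ_blocks (raise_blocks (Suc (length \<alpha>)) a E) \<alpha>"

text \<open>At the start the vertex \<open>k - 1\<close> has the leaf \<open>k\<close> as its only
  child. The root is never closed, hence one star fewer than numbers.\<close>

definition germ_string :: "nat \<Rightarrow> nat list \<Rightarrow> entry list" where
  "germ_string k \<alpha> = Num 0 # close_blocks (germ_blocks [[Num k]] \<alpha>)"

text \<open>Combines (b) with the exclusion of \<open>*k\<close> in (a), so that a single invariant
  on neighbours serves both.\<close>

fun adjacent_ok :: "nat \<Rightarrow> entry \<Rightarrow> entry \<Rightarrow> bool" where
  "adjacent_ok k (Num b) (Num c) \<longleftrightarrow> b < c"
| "adjacent_ok k Star (Num c) \<longleftrightarrow> c < k"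
| "adjacent_ok k _ Star \<longleftrightarrow> True"

text \<open>\<open>E\<close> lists the branches at the vertex \<open>i\<close>.\<close>

definition branches :: "nat \<Rightarrow> nat \<Rightarrow> entry list list \<Rightarrow> bool" where
  "branches k i E \<longleftrightarrow> [] \<notin> set E \<and> map hd E = map Num (rev [Suc i..<Suc i + length E]) \<and>
     successively (adjacent_ok k) (close_blocks E)"

text \<open>The bound \<open>b\<close> is explicit because it will be the number of branches present
  when \<open>germ_blocks\<close> reaches the entry.\<close>

primrec germ_from :: "nat \<Rightarrow> nat list \<Rightarrow> bool" where
  "germ_from b [] \<longleftrightarrow> True"
| "germ_from b (a # \<alpha>) \<longleftrightarrow> a \<le> b \<and> germ_from (Suc a) \<alpha>"

section \<open>Germs\<close>

lemma germ_from_iff: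
  "germ_from b \<alpha> \<longleftrightarrow> (\<alpha> \<noteq> [] \<longrightarrow> hd \<alpha> \<le> b) \<and> successively (\<lambda>x y. y \<le> Suc x) \<alpha>"
  by (induction \<alpha> arbitrary: b) (auto simp: successively_Cons)

text \<open>Subscript \<open>i\<close> is position \<open>k - 1 - i\<close> from the left, counted
  from 0; the bound 1 says that the leftmost entry is 0 or 1.\<close>

lemma germs_iff:
  assumes "1 < k"
  shows "\<alpha> \<in> germs k \<longleftrightarrow> length \<alpha> = k - 1 \<and> germ_from 1 \<alpha>"
proof (cases "length \<alpha> = k - 1")
  case len: True
  have "(\<forall>i. 1 < i \<and> i < k \<longrightarrow> \<alpha> ! (k - 1 - (i - 1)) \<le> \<alpha> ! (k - 1 - i) + 1) \<longleftrightarrow>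
      (\<forall>j. Suc j < k - 1 \<longrightarrow> \<alpha> ! Suc j \<le> Suc (\<alpha> ! j))" (is "?L \<longleftrightarrow> ?R")
  proof
    assume L: ?L
    show ?R
    proof (intro allI impI)
      fix j assume j: "Suc j < k - 1"
      define i where "i = k - 1 - j"
      then have "1 < i \<and> i < k" "k - 1 - i = j" "k - 1 - (i - 1) = Suc j"
        using j by auto
      with L show "\<alpha> ! Suc j \<le> Suc (\<alpha> ! j)" by (metis Suc_eq_plus1)
    qed
  next
    assume R: ?R
    show ?L
    proof (intro allI impI)
      fix i assume i: "1 < i \<and> i < k"
      then have "k - 1 - (i - 1) = Suc (k - 1 - i)" and "Suc (k - 1 - i) < k - 1"
        by auto
      then show "\<alpha> ! (k - 1 - (i - 1)) \<le> \<alpha> ! (k - 1 - i) + 1"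
        using R by simp
    qed
  qed
  moreover have "\<alpha> \<noteq> []" using len assms by auto
  ultimately show ?thesis
    using len assms
    by (auto simp: germs_def germ_entry_def germ_from_iff successively_conv_nth hd_conv_nth)
qed (simp add: germs_def)

lemma germ_from_replicate_0: "germ_from b (replicate n 0)"
  by (induction n arbitrary: b) auto

text \<open>Lowering an entry can only break the bound it puts on its right neighbour, and that
  neighbour, if any, is 0.\<close>

lemma germ_from_decrease:
  "germ_from b (p @ Suc m # replicate r 0) \<Longrightarrow> germ_from b (p @ m # replicate r 0)"
  by (induction p arbitrary: b) (auto simp: germ_from_replicate_0)

lemma rightmost_nonzero_decomp:
  assumes "\<alpha> \<noteq> replicate (length \<alpha>) 0"
  obtains p m r where "\<alpha> = p @ Suc m # replicate r 0"
  using assms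
proof (induction \<alpha> arbitrary: thesis rule: rev_induct)
  case (snoc a \<alpha>)
  show ?case
  proof (cases a)
    case 0
    with snoc.prems(2) have "\<alpha> \<noteq> replicate (length \<alpha>) 0"
      using replicate_append_same[of "length \<alpha>" "0::nat"] by auto
    then obtain p m r where "\<alpha> = p @ Suc m # replicate r 0"
      using snoc.IH by blast
    with 0 snoc.prems(1)[of p m "Suc r"] show ?thesis
      by (simp add: replicate_append_same)
  next
    case (Suc m)
    with snoc.prems(1)[of \<alpha> m 0] show ?thesis by simp
  qed
qed simp

lemma rightmost_nonzero_eq: "rightmost_nonzero (p @ Suc m # replicate r 0) = Suc r"
  unfolding rightmost_nonzero_def
proof (rule Least_equality)
  fix i
  assume "1 \<le> i \<and> i \<le> length (p @ Suc m # replicate r 0) \<and>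
    germ_entry (p @ Suc m # replicate r 0) i \<noteq> 0"
  \<comment> \<open>A smaller subscript would point into the trailing zeros.\<close>
  then show "Suc r \<le> i"
    by (rule contrapos_pp)
      (auto simp: germ_entry_def nth_append nth_Cons' not_le intro!: nth_replicate)
qed (simp add: germ_entry_def)

lemma germ_pred_eq: "germ_pred (p @ Suc m # replicate r 0) = p @ m # replicate r 0"
  by (simp add: germ_pred_def rightmost_nonzero_eq germ_entry_def list_update_append)

section \<open>The closed form\<close>

lemma close_blocks_simps [simp]:
  "close_blocks [] = []"
  "close_blocks (B # E) = B @ Star # close_blocks E"
  "close_blocks (E @ E') = close_blocks E @ close_blocks E'"
  by (simp_all add: close_blocks_def)

lemma close_blocks_eq_Nil [simp]: "close_blocks E = [] \<longleftrightarrow> E = []"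
  by (cases E) auto

lemma last_close_blocks: "E \<noteq> [] \<Longrightarrow> last (close_blocks E) = Star"
  by (induction E rule: rev_induct) auto

lemma hd_close_blocks: "E \<noteq> [] \<Longrightarrow> [] \<notin> set E \<Longrightarrow> hd (close_blocks E) = hd (hd E)"
  by (cases E) auto

lemma mset_close_blocks_take_drop:
  "mset (close_blocks (drop n E)) + mset (close_blocks (take n E)) = mset (close_blocks E)"
  by (metis add.commute append_take_drop_id close_blocks_simps(3) mset_append)

text \<open>Each raising permutes the closed blocks and inserts one new label with its star.\<close>

lemma mset_close_germ_blocks:
  "mset (close_blocks (germ_blocks E \<alpha>)) =
     mset (close_blocks E) + image_mset Num (mset_set {1..length \<alpha>}) + replicate_mset (length \<alpha>) Star"
proof (induction \<alpha> arbitrary: E)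
  case (Cons a \<alpha>)
  have "mset (close_blocks (raise_blocks i a E)) = mset (close_blocks E) + {#Num i, Star#}" for i
    by (simp add: raise_blocks_def flip: mset_close_blocks_take_drop[of "length E - a" E])
  with Cons show ?case
    by (simp add: atLeastAtMostSuc_conv)
qed simp

text \<open>Raising with \<open>a = 0\<close> puts all branches below the new vertex, so trailing
  zeros build a path. This path is the source of the fixed ends \<open>W\<close> and
  \<open>Z\<close>.\<close>

lemma close_germ_blocks_replicate_0:
  "close_blocks (germ_blocks E (replicate r 0)) =
     map Num [1..<Suc r] @ close_blocks E @ replicate r Star"
  by (induction r arbitrary: E) (simp_all add: raise_blocks_def replicate_append_same)

lemma length_raise_blocks: "a \<le> length E \<Longrightarrow> length (raise_blocks i a E) = Suc a"
  by (simp add: raise_blocks_def)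

section \<open>Labels and neighbours of the branches at a vertex\<close>

lemma hd_branch:
  assumes "branches k i E" "j < length E"
  shows "hd (E ! j) = Num (i + length E - j)"
proof -
  have "map hd E ! j = map Num (rev [Suc i..<Suc i + length E]) ! j"
    using assms(1) by (simp only: branches_def)
  then show ?thesis using assms(2) by (simp add: rev_nth del: upt_Suc)
qed

text \<open>The moved branches keep their descending labels and \<open>Suc i\<close> ends the list.
  The new contacts are harmless: a star may precede \<open>Suc i\<close> as
  \<open>Suc i < k\<close>, and the first branch left below \<open>Suc i\<close> has the larger
  label \<open>Suc i + length E\<close>.\<close>

lemma branches_raise_blocks:
  assumes E: "branches k (Suc i) E" and a: "a \<le> length E" and i: "Suc i < k"
  shows "branches k i (raise_blocks (Suc i) a E)"
proof -
  define n where "n = length E - a"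
  have "map hd (drop n E) = map Num (rev [Suc (Suc i)..<Suc (Suc i) + a])"
  proof -
    have "map hd (drop n E) = drop n (map hd E)"
      by (simp add: drop_map)
    also have "\<dots> = drop n (map Num (rev [Suc (Suc i)..<Suc (Suc i) + length E]))"
      using E by (simp only: branches_def)
    finally show ?thesis
      using a by (simp add: n_def drop_map drop_rev take_upt del: upt_Suc)
  qed
  moreover have "rev [Suc i..<Suc i + Suc a] = rev [Suc (Suc i)..<Suc (Suc i) + a] @ [Suc i]"
    by (subst upt_conv_Cons) auto
  ultimately have hds: "map hd (raise_blocks (Suc i) a E) = map Num (rev [Suc i..<Suc i + Suc a])"
    by (simp add: raise_blocks_def n_def del: upt_Suc)
  have "successively (adjacent_ok k) (close_blocks (take n E) @ close_blocks (drop n E))"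
    using E by (simp add: branches_def flip: close_blocks_simps(3))
  then have "successively (adjacent_ok k) (close_blocks (take n E))"
    and "successively (adjacent_ok k) (close_blocks (drop n E))"
    by (auto simp: successively_append_iff)
  moreover have "adjacent_ok k (Num (Suc i)) (hd (close_blocks (take n E)))" if "take n E \<noteq> []"
  proof -
    have "[] \<notin> set (take n E)"
      using E by (auto simp: branches_def dest: in_set_takeD)
    then have "hd (close_blocks (take n E)) = hd (E ! 0)"
      using that by (simp add: hd_close_blocks flip: hd_conv_nth)
    also have "\<dots> = Num (Suc i + length E)"
      using that hd_branch[OF E, of 0] by (simp add: length_greater_0_conv)
    finally show ?thesis using that by simp
  qed
  moreover have "adjacent_ok k (last (close_blocks (drop n E))) (Num (Suc i))" if "drop n E \<noteq> []"
    using i by (simp only: last_close_blocks[OF that]) simp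
  ultimately have "successively (adjacent_ok k) (close_blocks (raise_blocks (Suc i) a E))"
    by (cases "take n E = []"; cases "drop n E = []")
      (auto simp: raise_blocks_def successively_append_iff successively_Cons last_close_blocks
        hd_append simp flip: n_def)
  moreover have "[] \<notin> set (raise_blocks (Suc i) a E)"
    using E by (auto simp: raise_blocks_def branches_def dest: in_set_dropD)
  ultimately show ?thesis
    using hds a by (simp add: branches_def length_raise_blocks)
qed

lemma branches_germ_blocks:
  assumes "branches k (length \<alpha>) E" "length \<alpha> < k" "germ_from (length E) \<alpha>"
  shows "branches k 0 (germ_blocks E \<alpha>)"
  using assms
  by (induction \<alpha> arbitrary: E) (auto simp: branches_raise_blocks length_raise_blocks)

text \<open>A germ and its predecessor agree on \<open>p\<close>, so both reach the same branches
  \<open>E'\<close> before the entry \<open>x\<close> in which they differ.\<close>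

lemma germ_blocks_prefix:
  assumes "branches k (length p + i) E" "length p + i < k" "germ_from (length E) (p @ a # q)"
    "i = Suc (length q)"
  obtains E' where "branches k i E'" "a \<le> length E'"
    "\<And>x. germ_blocks E (p @ x # q) = germ_blocks (raise_blocks i x E') q"
  using assms
proof (induction p arbitrary: E thesis)
  case Nil
  then show ?case by auto
next
  case (Cons b p)
  let ?E = "raise_blocks (Suc (length p + i)) b E"
  have "branches k (length p + i) ?E" "germ_from (length ?E) (p @ a # q)"
    using Cons.prems by (auto simp: branches_raise_blocks length_raise_blocks)
  then obtain E' where "branches k i E'" "a \<le> length E'"
    "\<And>x. germ_blocks ?E (p @ x # q) = germ_blocks (raise_blocks i x E') q"
    using Cons.IH Cons.prems(3,5) by (metis add_lessD1 add_Suc length_Cons Suc_lessD)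
  with Cons.prems(1,5) show ?case by simp
qed

lemma branches_top: "0 < k \<Longrightarrow> branches k (k - 1) [[Num k]]"
  by (simp add: branches_def)

section \<open>The initial string and a single castling\<close>

lemma germ_string_null:
  assumes "1 < k"
  shows "germ_string k (null_germ k) = map Num [0..<k + 1] @ replicate k Star"
proof -
  obtain n where "k = Suc n" using assms by (cases k) auto
  then show ?thesis
    by (simp add: germ_string_def null_germ_def close_germ_blocks_replicate_0 upt_conv_Cons
        del: upt_Suc) (simp add: upt_conv_Cons)
qed

text \<open>Passing from \<open>m\<close> to \<open>Suc m\<close> moves one closed branch
  \<open>Y\<close> to the front of the middle part; everything else there is
  \<open>X\<close>.\<close>

lemma germ_string_castling:
  assumes k: "1 < k" and \<alpha>: "\<alpha> \<in> germs k" "\<alpha> = p @ Suc m # replicate r 0"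
  obtains X Y where
    "germ_string k (p @ m # replicate r 0) =
       map Num [0..<Suc r] @ X @ Y @ replicate (Suc r) Star"
    "germ_string k \<alpha> = map Num [0..<Suc r] @ Y @ X @ replicate (Suc r) Star"
    "X \<noteq> []" "hd X = Num (Suc r + m)" "Y \<noteq> []" "hd Y = Num (Suc r + m + 1)"
proof -
  have len: "length p + Suc r = k - 1"
    and germ: "germ_from (length [[Num k]]) (p @ Suc m # replicate r 0)"
    using \<alpha> k by (auto simp: germs_iff)
  have "branches k (length p + Suc r) [[Num k]]" "length p + Suc r < k"
    using len k branches_top[of k] by auto
  then obtain E where E: "branches k (Suc r) E" "Suc m \<le> length E"
    "\<And>x. germ_blocks [[Num k]] (p @ x # replicate r 0) =
       germ_blocks (raise_blocks (Suc r) x E) (replicate r 0)"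
    by (rule germ_blocks_prefix[OF _ _ germ]) (simp, blast)
  \<comment> \<open>The index of the rightmost branch still below \<open>Suc r\<close> before the
    castling.\<close>
  define n where "n = length E - Suc m"
  have n: "length E - m = Suc n" "n < length E"
    using E(2) by (auto simp: n_def)
  \<comment> \<open>Of the \<open>Suc r\<close> final stars, one closes the vertex
    \<open>Suc r\<close> and \<open>r\<close> close the path.\<close>
  have F: "germ_string k (p @ x # replicate r 0) =
      map Num [0..<Suc r] @ close_blocks (drop (length E - x) E) @
        Num (Suc r) # close_blocks (take (length E - x) E) @ replicate (Suc r) Star" for x
    by (simp add: germ_string_def E(3) close_germ_blocks_replicate_0 raise_blocks_def upt_conv_Cons
        replicate_append_same del: upt_Suc)
  let ?X = "close_blocks (drop (Suc n) E) @ Num (Suc r) # close_blocks (take n E)"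
  let ?Y = "close_blocks [E ! n]"
  have "[] \<notin> set E"
    using E(1) by (simp add: branches_def)
  then have nonempty: "[] \<notin> set (drop (Suc n) E)" "E ! n \<noteq> []"
    using n(2) by (meson in_set_dropD, metis nth_mem)
  show thesis
  proof
    show "germ_string k (p @ m # replicate r 0) =
        map Num [0..<Suc r] @ ?X @ ?Y @ replicate (Suc r) Star"
      using n by (simp add: F take_Suc_conv_app_nth del: upt_Suc)
    show "germ_string k \<alpha> = map Num [0..<Suc r] @ ?Y @ ?X @ replicate (Suc r) Star"
      using n by (simp add: F \<alpha> Cons_nth_drop_Suc[symmetric] flip: n_def del: upt_Suc)
    \<comment> \<open>For \<open>m = 0\<close> no branch has moved yet and \<open>X\<close> starts
      with the vertex \<open>Suc r\<close> itself; otherwise it starts with the branch moved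
      last.\<close>
    show "hd ?X = Num (Suc r + m)"
    proof (cases "m = 0")
      case True
      then show ?thesis using n by simp
    next
      case False
      then have "Suc n < length E" using n by simp
      then show ?thesis
        using n nonempty hd_branch[OF E(1), of "Suc n"]
        by (simp add: hd_append hd_close_blocks hd_drop_conv_nth)
    qed
    show "hd ?Y = Num (Suc r + m + 1)"
      using n nonempty hd_branch[OF E(1), of n] by simp
  qed auto
qed

section \<open>Entries and neighbours in the closed form\<close>

lemma germ_string_mset:
  assumes "1 < k" "\<alpha> \<in> germs k"
  shows "mset (germ_string k \<alpha>) = image_mset Num (mset_set {0..k}) + replicate_mset k Star"
proof -
  obtain n where n: "k = Suc n" using assms(1) by (cases k) auto
  have "{0..k} = insert 0 (insert k {1..n})"
    using n by auto
  then show ?thesis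
    using assms n
    by (simp add: germ_string_def mset_close_germ_blocks germs_iff)
qed

lemma germ_string_castling_strings:
  assumes "1 < k" "\<alpha> \<in> germs k"
  shows "germ_string k \<alpha> \<in> castling_strings k"
proof -
  have "length (germ_string k \<alpha>) = size (mset (germ_string k \<alpha>))"
    by simp
  also have "\<dots> = 2 * k + 1"
    by (simp add: germ_string_mset[OF assms] del: size_mset)
  finally show ?thesis
    by (simp add: castling_strings_def germ_string_mset[OF assms])
qed

lemma germ_string_adjacent:
  assumes "1 < k" "\<alpha> \<in> germs k"
  shows "successively (adjacent_ok k) (germ_string k \<alpha>)" "last (germ_string k \<alpha>) = Star"
proof -
  let ?E = "germ_blocks [[Num k]] \<alpha>"
  have E: "branches k 0 ?E"
    using assms branches_top[of k] by (intro branches_germ_blocks) (auto simp: germs_iff)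
  \<comment> \<open>The label \<open>k\<close> shows that the root has a branch, so the string ends
    in a star and 0 is followed by a positive label.\<close>
  have "Num k \<in># mset (close_blocks ?E)"
    by (simp only: mset_close_germ_blocks) simp
  then have "?E \<noteq> []" by auto
  moreover from this have "hd (close_blocks ?E) = Num (length ?E)"
    using E hd_branch[OF E, of 0] by (simp add: hd_close_blocks branches_def flip: hd_conv_nth)
  ultimately show "successively (adjacent_ok k) (germ_string k \<alpha>)"
    "last (germ_string k \<alpha>) = Star"
    using E by (auto simp: germ_string_def branches_def successively_Cons last_close_blocks)
qed

lemma successively_sublist:
  "successively P xs \<Longrightarrow> sublist [x, y] xs \<Longrightarrow> P x y"
  by (auto simp: sublist_def successively_append_iff)

text \<open>The string ends in a star, so \<open>k\<close> has a right neighbour; a number there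
  would have to exceed \<open>k\<close>.\<close>

lemma germ_string_sublist_k:
  assumes "1 < k" "\<alpha> \<in> germs k"
  shows "sublist [Num k, Star] (germ_string k \<alpha>)"
proof -
  have set: "set (germ_string k \<alpha>) \<subseteq> insert Star (Num ` {0..k})" "Num k \<in> set (germ_string k \<alpha>)"
    using arg_cong[OF germ_string_mset[OF assms], of set_mset] by auto
  then obtain xs ys where split: "germ_string k \<alpha> = xs @ Num k # ys"
    by (meson split_list)
  with germ_string_adjacent(2)[OF assms] obtain y zs where ys: "ys = y # zs"
    by (cases ys) auto
  have "sublist [Num k, y] (germ_string k \<alpha>)"
    unfolding split ys sublist_def by (metis append_Cons append_Nil)
  then have "adjacent_ok k (Num k) y"
    by (rule successively_sublist[OF germ_string_adjacent(1)[OF assms]])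
  moreover have "y \<in> insert Star (Num ` {0..k})"
    using set split ys by auto
  ultimately have "y = Star" by auto
  with \<open>sublist [Num k, y] (germ_string k \<alpha>)\<close> show ?thesis by simp
qed

section \<open>Castling is deterministic\<close>

lemma split_unique:
  assumes "xs @ y # ys = xs' @ y # ys'" "count (mset (xs @ y # ys)) y \<le> 1"
  shows "xs = xs' \<and> ys = ys'"
proof -
  have "y \<notin> set xs" "y \<notin> set ys"
    using assms(2) by (auto simp: count_eq_zero_iff)
  then show ?thesis
    using assms(1) by (simp add: append_Cons_eq_iff)
qed

text \<open>The leftmost entry of \<open>X @ Y\<close> fixes \<open>\<Omega>\<close>, and the only
  occurrence of \<open>\<Omega> + 1\<close> fixes the cut.\<close>

lemma castling_unique:
  assumes "castling i h g" "castling i h g'" "\<And>c. count (mset h) (Num c) \<le> 1"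
  shows "g = g'"
proof -
  obtain X Y \<Omega> where 1: "h = initial_substring i h @ X @ Y @ terminal_substring i h"
    "X \<noteq> []" "hd X = Num \<Omega>" "Y \<noteq> []" "hd Y = Num (\<Omega> + 1)"
    "g = initial_substring i h @ Y @ X @ terminal_substring i h"
    using assms(1) unfolding castling_def by blast
  obtain X' Y' \<Omega>' where 2: "h = initial_substring i h @ X' @ Y' @ terminal_substring i h"
    "X' \<noteq> []" "hd X' = Num \<Omega>'" "Y' \<noteq> []" "hd Y' = Num (\<Omega>' + 1)"
    "g' = initial_substring i h @ Y' @ X' @ terminal_substring i h"
    using assms(2) unfolding castling_def by blast
  have eq: "X @ Y = X' @ Y'"
    using 1(1) 2(1) by (metis append.assoc append_same_eq same_append_eq)
  then have "hd X = hd X'"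
    using 1(2) 2(2) by (metis hd_append2)
  then have \<Omega>: "\<Omega>' = \<Omega>" using 1(3) 2(3) by simp
  obtain y y' where Y: "Y = Num (\<Omega> + 1) # y" "Y' = Num (\<Omega> + 1) # y'"
    using 1(4,5) 2(4,5) \<Omega> by (metis list.collapse)
  have "count (mset (X @ Y)) (Num (\<Omega> + 1)) \<le> count (mset h) (Num (\<Omega> + 1))"
    by (subst 1(1)) simp
  then have "count (mset (X @ Y)) (Num (\<Omega> + 1)) \<le> 1"
    using assms(3) le_trans by blast
  then have "X = X' \<and> y = y'"
    using eq unfolding Y by (intro split_unique)
  with 1(6) 2(6) Y show ?thesis by simp
qed

section \<open>The closed form as the unique solution of the recursion\<close>

lemma count_germ_string:
  assumes "1 < k" "\<alpha> \<in> germs k"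
  shows "count (mset (germ_string k \<alpha>)) (Num c) \<le> 1"
proof -
  have "image_mset Num (mset_set {0..k}) = mset_set (Num ` {0..k})"
    by (rule image_mset_mset_set) (simp add: inj_on_def)
  then show ?thesis
    by (simp add: germ_string_mset[OF assms] count_mset_set')
qed

lemma castling_germ_string:
  assumes "1 < k" "\<alpha> \<in> germs k" "\<alpha> \<noteq> null_germ k"
  defines "i \<equiv> rightmost_nonzero \<alpha>"
  defines "h \<equiv> germ_string k (germ_pred \<alpha>)"
  shows "castling i h (germ_string k \<alpha>)"
    "initial_substring i h = map Num [0..<i]"
    "initial_substring i (germ_string k \<alpha>) = map Num [0..<i]"
    "terminal_substring i h = replicate i Star"
    "terminal_substring i (germ_string k \<alpha>) = replicate i Star"
    "germ_pred \<alpha> \<in> germs k" "sum_list (germ_pred \<alpha>) < sum_list \<alpha>"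
proof -
  have "\<alpha> \<noteq> replicate (length \<alpha>) 0"
    using assms(1-3) by (auto simp: germs_iff null_germ_def)
  then obtain p m r where \<alpha>: "\<alpha> = p @ Suc m # replicate r 0"
    by (rule rightmost_nonzero_decomp)
  have i: "i = Suc r" and pred: "germ_pred \<alpha> = p @ m # replicate r 0"
    by (simp_all add: i_def \<alpha> rightmost_nonzero_eq germ_pred_eq)
  show "germ_pred \<alpha> \<in> germs k"
    using assms(1,2) germ_from_decrease[of 1 p m r] by (simp add: germs_iff pred) (simp add: \<alpha>)
  show "sum_list (germ_pred \<alpha>) < sum_list \<alpha>"
    by (simp add: pred, simp add: \<alpha>)
  obtain X Y where XY: "h = map Num [0..<i] @ X @ Y @ replicate i Star"
    "germ_string k \<alpha> = map Num [0..<i] @ Y @ X @ replicate i Star"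
    "X \<noteq> []" "hd X = Num (i + m)" "Y \<noteq> []" "hd Y = Num (i + m + 1)"
    using germ_string_castling[OF assms(1,2) \<alpha>] unfolding h_def pred i by metis
  show W: "initial_substring i h = map Num [0..<i]"
    "initial_substring i (germ_string k \<alpha>) = map Num [0..<i]"
    and Z: "terminal_substring i h = replicate i Star"
    "terminal_substring i (germ_string k \<alpha>) = replicate i Star"
    by (simp_all add: XY(1,2) initial_substring_def terminal_substring_def del: replicate.simps)
  \<comment> \<open>Here \<open>\<Omega>\<close> is \<open>i + m\<close>, positive because
    \<open>i = Suc r\<close>.\<close>
  show "castling i h (germ_string k \<alpha>)"
    unfolding castling_def W Z using XY i by (metis add_gr_0 zero_less_Suc)
qed

text \<open>Induction on the sum of the entries, which \<open>germ_pred\<close> lowers: both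
  functions castle the same string, whose numbers are distinct.\<close>

lemma castling_recursion_unique:
  assumes k: "1 < k" and G: "castling_recursion k G" and \<alpha>: "\<alpha> \<in> germs k"
  shows "G \<alpha> = germ_string k \<alpha>"
  using \<alpha>
proof (induction \<alpha> rule: measure_induct_rule[of sum_list])
  case (less \<alpha>)
  show ?case
  proof (cases "\<alpha> = null_germ k")
    case True
    with G k show ?thesis by (simp add: castling_recursion_def germ_string_null)
  next
    case False
    note F = castling_germ_string[OF k less.prems False]
    have "castling (rightmost_nonzero \<alpha>) (G (germ_pred \<alpha>)) (G \<alpha>)"
      using G less.prems False by (simp add: castling_recursion_def)
    moreover have "G (germ_pred \<alpha>) = germ_string k (germ_pred \<alpha>)"
      using F less.IH by blast
    ultimately show ?thesis
      using castling_unique[OF _ F(1)] count_germ_string[OF k F(6)] by metis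
  qed
qed

theorem theorem2:
  fixes k :: nat
  assumes "1 < k"
  shows "\<exists>F :: nat list \<Rightarrow> entry list.
    castling_recursion k F \<and>
    (\<forall>G. castling_recursion k G \<longrightarrow> (\<forall>\<alpha> \<in> germs k. G \<alpha> = F \<alpha>)) \<and>
    (\<forall>\<alpha> \<in> germs k.
       F \<alpha> \<in> castling_strings k \<and>
       hd (F \<alpha>) = Num 0 \<and>
       sublist [Num k, Star] (F \<alpha>) \<and>
       \<not> sublist [Star, Num k] (F \<alpha>) \<and>
       (\<forall>b c. b \<in> {0..k - 1} \<and> sublist [Num b, Num c] (F \<alpha>) \<longrightarrow> b < c)) \<and>
    (\<forall>\<alpha> \<in> germs k. \<alpha> \<noteq> null_germ k \<longrightarrow>
       (let i = rightmost_nonzero \<alpha>;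
            W = initial_substring i (F (germ_pred \<alpha>));
            Z = terminal_substring i (F (germ_pred \<alpha>))
        in initial_substring i (F \<alpha>) = W \<and> terminal_substring i (F \<alpha>) = Z \<and>
           length W = i \<and> ascending_numbers W \<and>
           Z = replicate i Star))"
proof (intro exI conjI ballI allI impI)
  let ?F = "germ_string k"
  show "castling_recursion k ?F"
    using assms by (simp add: castling_recursion_def germ_string_null castling_germ_string(1))
  show "G \<alpha> = ?F \<alpha>" if "castling_recursion k G" "\<alpha> \<in> germs k" for G \<alpha>
    using castling_recursion_unique[OF assms that] .
  fix \<alpha> assume \<alpha>: "\<alpha> \<in> germs k"
  note adj = successively_sublist[OF germ_string_adjacent(1)[OF assms \<alpha>]]
  show "?F \<alpha> \<in> castling_strings k"
    using germ_string_castling_strings[OF assms \<alpha>] .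
  show "hd (?F \<alpha>) = Num 0"
    by (simp add: germ_string_def)
  show "sublist [Num k, Star] (?F \<alpha>)"
    using germ_string_sublist_k[OF assms \<alpha>] .
  show "\<not> sublist [Star, Num k] (?F \<alpha>)"
    using adj by force
  show "b < c" if "b \<in> {0..k - 1} \<and> sublist [Num b, Num c] (?F \<alpha>)" for b c
    using adj[of "Num b" "Num c"] that by simp
  show "let i = rightmost_nonzero \<alpha>;
            W = initial_substring i (?F (germ_pred \<alpha>));
            Z = terminal_substring i (?F (germ_pred \<alpha>))
        in initial_substring i (?F \<alpha>) = W \<and> terminal_substring i (?F \<alpha>) = Z \<and>
           length W = i \<and> ascending_numbers W \<and> Z = replicate i Star"
    if "\<alpha> \<noteq> null_germ k"
    \<comment> \<open>\<open>W\<close> lists the labels 0 to \<open>i - 1\<close> of the path from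
      the root.\<close>
    using castling_germ_string(2-5)[OF assms \<alpha> that]
    by (auto simp: Let_def ascending_numbers_def intro!: exI[of _ "[0..<rightmost_nonzero \<alpha>]"])
qed

end
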